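(* Let $f:\mathbb{R}^n\to\mathbb{R}$ be closed, proper and $\sigma$-strongly convex with $\sigma>0$, let $\gamma\in(0,2]$, $\beta>0$, $\beta^k=\beta/(\tau^k)^2$, where $\tau^k>0$, $1/(\tau^{k-1})^2=(1-\tau^k)/(\tau^k)^2$ for $k\ge0$ and $\tau^{-1}\in(0,1)$. Let either $D=A^TA$, or $D=\|A\|^2I_n$ and in this case assume $\beta\|A\|^2/(\tau^k)^2+\sigma/\tau^k\ge\beta\|A\|^2/(\tau^{k+1})^2$ for all $k\ge 0$. Let $\{x^k\}$ be generated, for $k\ge0$, by $$\hat\lambda^k=\lambda^k-(1-\tau^k)\beta^k(Ax^k-b),\qquad \hat x^k=x^k+\frac{\tau^k(1-\tau^{k-1})}{\tau^{k-1}}(x^k-x^{k-1}),$$ $$x^{k+1}\in\arg\min_x\Big\{f(x)+x^T\nabla_x\varphi^k(\hat x^k,\hat\lambda^k)+\frac{\beta^k}{2}\|x-\hat x^k\|_D^2+\frac{\sigma(1-\tau^k)}{2\tau^k}\|x-x^k\|^2\Big\},$$ with $\lambda^{k+1}$ chosen so that $\bar\lambda^{k+1}=\bar\lambda^k-\gamma\tau^k\beta^k(A\bar x^{k+1}-b)$. Then for all $x'\in\Omega$, $\lambda\in\mathbb{R}^l$ and $k\ge0$, $$\frac{1}{(\tau^k)^2}\Big[S^{k+1}-\frac{(2-\gamma)\beta}{2(\tau^k)^2}\|A\breve x^k-b\|^2\Big]-\frac{1}{(\tau^{k-1})^2}\Big[S^{k}-\frac{(2-\gamma)\beta}{2(\tau^{k-1})^2}\|A\breve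 x^{k-1}-b\|^2\Big]$$ $$\ge\frac12\Big(\|v^{k+1}-v'\|^2_{H_0^{k+1}}-\|v^k-v'\|^2_{H_0^k}+\sigma\frac{1-\tau^k}{(\tau^k)^3}\|\breve x^k-\breve x^{k-1}\|^2\Big).$$ Consequently, taking $u'=u^*$ for a saddle point $u^*=(x^*,\lambda^* )$ of the Lagrangian, $$\min_{0\le i\le k}\|\breve x^i-\breve x^{i-1}\|^2=O(1/k^4).$$
   Context: Problem: minimize $f(x)$ subject to $Ax=b$, $A\in\mathbb{R}^{l\times n}$, $b\in\mathbb{R}^l$, $\Omega=\{x:Ax=b\}$. A saddle point $(x^*,\lambda^* )$ of $L(x,\lambda)=f(x)-\lambda^T(Ax-b)$, satisfying $L(x^*,\lambda)\le L(x^*,\lambda^* )\le L(x,\lambda^* )$ for all $x,\lambda$, is assumed to exist where used. $f$ is $\sigma$-strongly convex if $f(y)\ge f(x)+\langle f'(x),y-x\rangle+\frac\sigma2\|y-x\|^2$ for all $x,y$ and all $f'(x)\in\partial f(x)$. $\varphi^k(x,\lambda):=-\lambda^T(Ax-b)+\frac{\beta^k}{2}\|Ax-b\|^2$. Initial points $x^{-1},x^0\in\mathbb{R}^n$, $\lambda^0\in\mathbb{R}^l$ are given. $\bar x^{k+1}:=x^{k+1}/\tau^k-(1-\tau^k)x^k/\tau^k$ for $k\ge-1$; $\breve x^k:=x^{k+1}$ for $k\ge -1$; $\bar\lambda^k:=\lambda^k-\gamma(1-\tau^k)\beta^k(A\breve x^{k-1}-b)$; $v^k:=(\bar x^k,\bar\lambda^k)$;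 $v'=u'=(x',\lambda)$. (The required recursion for $\bar\lambda^{k+1}$ amounts to $\lambda^{k+1}=\lambda^k$.) $S^{k+1}:=f(x')-f(\breve x^k)+\lambda^T(A\breve x^k-b)$. $H_0^k=\begin{pmatrix}\frac{\beta}{(\tau^k)^2}(D-A^TA)&0\\0&\frac1{\gamma\beta}I_l\end{pmatrix}$ (whose upper-left block is $0$ when $D=A^TA$). $\|w\|_D^2:=w^TDw$, and $\|A\|$ is the spectral norm. *)

theory Defs
  imports "HOL-Analysis.Analysis" "HOL-Library.Landau_Symbols"
begin

text \<open>
  Sequences carry integer indices, because the iterates and the parameters start at index -1.
  Values at indices below -1 are irrelevant.
\<close>

section \<open>Convex analysis\<close>

definition closed_fun :: "('a::topological_space \<Rightarrow> real) \<Rightarrow> bool" where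
  "closed_fun f \<longleftrightarrow> closed (epigraph UNIV f)"

definition proper_fun :: "('a \<Rightarrow> ereal) \<Rightarrow> bool" where
  "proper_fun f \<longleftrightarrow> (\<forall>x. f x \<noteq> -\<infinity>) \<and> (\<exists>x. f x \<noteq> \<infinity>)"

definition subdifferential :: "('a::real_inner \<Rightarrow> real) \<Rightarrow> 'a \<Rightarrow> 'a set" where
  "subdifferential f x = {g. \<forall>y. f y \<ge> f x + g \<bullet> (y - x)}"

text \<open>
  Convexity is stated explicitly: for a nonconvex function the subdifferential can be empty
  everywhere, and then the inequality alone would say nothing.
\<close>

definition strongly_convex :: "real \<Rightarrow> ('a::real_inner \<Rightarrow> real) \<Rightarrow> bool" where
  "strongly_convex \<sigma> f \<longleftrightarrow> convex_on UNIV f \<and>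
     (\<forall>x y. \<forall>g \<in> subdifferential f x.
        f y \<ge> f x + g \<bullet> (y - x) + \<sigma> / 2 * (norm (y - x))\<^sup>2)"

definition gradient :: "('a::real_inner \<Rightarrow> real) \<Rightarrow> 'a \<Rightarrow> 'a" where
  "gradient f x = (THE D. GDERIV f x :> D)"

section \<open>Matrices\<close>

text \<open>
  The norm of type class \<open>real_normed_vector\<close> on matrices is the Frobenius norm, so the
  spectral norm is taken as the operator norm with respect to the Euclidean norms.
\<close>

definition spectral_norm :: "real^'n^'l \<Rightarrow> real" where
  "spectral_norm A = onorm ((*v) A)"

definition sqnorm_mat :: "real^'n^'n \<Rightarrow> real^'n \<Rightarrow> real" where
  "sqnorm_mat D w = w \<bullet> (D *v w)"

definition stack :: "real^'n \<Rightarrow> real^'l \<Rightarrow> real^('n + 'l)" where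
  "stack x y = (\<chi> i. case i of Inl a \<Rightarrow> x $ a | Inr b \<Rightarrow> y $ b)"

definition block_diag :: "real^'n^'n \<Rightarrow> real^'l^'l \<Rightarrow> real^('n + 'l)^('n + 'l)" where
  "block_diag P Q = (\<chi> i j.
     case i of
       Inl a \<Rightarrow> (case j of Inl c \<Rightarrow> P $ a $ c | Inr d \<Rightarrow> 0)
     | Inr b \<Rightarrow> (case j of Inl c \<Rightarrow> 0 | Inr d \<Rightarrow> Q $ b $ d))"

section \<open>The problem: minimize f subject to A x = b\<close>

definition feasible :: "real^'n^'l \<Rightarrow> real^'l \<Rightarrow> (real^'n) set" where
  "feasible A b = {x. A *v x = b}"

definition lagrangian ::
  "(real^'n \<Rightarrow> real) \<Rightarrow> real^'n^'l \<Rightarrow> real^'l \<Rightarrow> real^'n \<Rightarrow> real^'l \<Rightarrow> real" where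
  "lagrangian f A b x lam = f x - lam \<bullet> (A *v x - b)"

definition saddle_point ::
  "(real^'n \<Rightarrow> real) \<Rightarrow> real^'n^'l \<Rightarrow> real^'l \<Rightarrow> real^'n \<Rightarrow> real^'l \<Rightarrow> bool" where
  "saddle_point f A b xs lams \<longleftrightarrow>
     (\<forall>x lam. lagrangian f A b xs lam \<le> lagrangian f A b xs lams \<and>
              lagrangian f A b xs lams \<le> lagrangian f A b x lams)"

section \<open>Quantities of the algorithm\<close>

definition beta_seq :: "real \<Rightarrow> (int \<Rightarrow> real) \<Rightarrow> int \<Rightarrow> real" where
  "beta_seq \<beta> \<tau> k = \<beta> / (\<tau> k)\<^sup>2"

definition phi :: "real^'n^'l \<Rightarrow> real^'l \<Rightarrow> real \<Rightarrow> real^'n \<Rightarrow> real^'l \<Rightarrow> real" where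
  "phi A b \<beta>k x lam = - (lam \<bullet> (A *v x - b)) + \<beta>k / 2 * (norm (A *v x - b))\<^sup>2"

text \<open>The defining formula, read at index k, uses the iterates k and k - 1 (k \<ge> 0).\<close>

definition xbar :: "(int \<Rightarrow> real) \<Rightarrow> (int \<Rightarrow> real^'n) \<Rightarrow> int \<Rightarrow> real^'n" where
  "xbar \<tau> x k = (1 / \<tau> (k - 1)) *\<^sub>R x k - ((1 - \<tau> (k - 1)) / \<tau> (k - 1)) *\<^sub>R x (k - 1)"

definition xbreve :: "(int \<Rightarrow> real^'n) \<Rightarrow> int \<Rightarrow> real^'n" where
  "xbreve x k = x (k + 1)"

definition lambar ::
  "real^'n^'l \<Rightarrow> real^'l \<Rightarrow> real \<Rightarrow> real \<Rightarrow> (int \<Rightarrow> real) \<Rightarrow> (int \<Rightarrow> real^'n) \<Rightarrow> (int \<Rightarrow> real^'l)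
     \<Rightarrow> int \<Rightarrow> real^'l" where
  "lambar A b \<beta> \<gamma> \<tau> x lam k =
     lam k - (\<gamma> * (1 - \<tau> k) * beta_seq \<beta> \<tau> k) *\<^sub>R (A *v xbreve x (k - 1) - b)"

definition lamhat ::
  "real^'n^'l \<Rightarrow> real^'l \<Rightarrow> real \<Rightarrow> (int \<Rightarrow> real) \<Rightarrow> (int \<Rightarrow> real^'n) \<Rightarrow> (int \<Rightarrow> real^'l)
     \<Rightarrow> int \<Rightarrow> real^'l" where
  "lamhat A b \<beta> \<tau> x lam k =
     lam k - ((1 - \<tau> k) * beta_seq \<beta> \<tau> k) *\<^sub>R (A *v x k - b)"

definition xhat :: "(int \<Rightarrow> real) \<Rightarrow> (int \<Rightarrow> real^'n) \<Rightarrow> int \<Rightarrow> real^'n" where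
  "xhat \<tau> x k = x k + (\<tau> k * (1 - \<tau> (k - 1)) / \<tau> (k - 1)) *\<^sub>R (x k - x (k - 1))"

definition v_seq ::
  "real^'n^'l \<Rightarrow> real^'l \<Rightarrow> real \<Rightarrow> real \<Rightarrow> (int \<Rightarrow> real) \<Rightarrow> (int \<Rightarrow> real^'n) \<Rightarrow> (int \<Rightarrow> real^'l)
     \<Rightarrow> int \<Rightarrow> real^('n + 'l)" where
  "v_seq A b \<beta> \<gamma> \<tau> x lam k = stack (xbar \<tau> x k) (lambar A b \<beta> \<gamma> \<tau> x lam k)"

text \<open>
  The quantity S at index k (not k + 1) for the reference point (x', l); hence the shifted
  index of \<open>xbreve\<close>.
\<close>

definition S_seq ::
  "(real^'n \<Rightarrow> real) \<Rightarrow> real^'n^'l \<Rightarrow> real^'l \<Rightarrow> (int \<Rightarrow> real^'n) \<Rightarrow> real^'n \<Rightarrow> real^'l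
     \<Rightarrow> int \<Rightarrow> real" where
  "S_seq f A b x x' l k =
     f x' - f (xbreve x (k - 1)) + l \<bullet> (A *v xbreve x (k - 1) - b)"

definition H0 ::
  "real^'n^'l \<Rightarrow> real^'n^'n \<Rightarrow> real \<Rightarrow> real \<Rightarrow> (int \<Rightarrow> real) \<Rightarrow> int \<Rightarrow> real^('n + 'l)^('n + 'l)" where
  "H0 A D \<beta> \<gamma> \<tau> k =
     block_diag ((\<beta> / (\<tau> k)\<^sup>2) *\<^sub>R (D - transpose A ** A)) ((1 / (\<gamma> * \<beta>)) *\<^sub>R mat 1)"

end

theory Submission
  imports Defs
begin

text \<open>
  Optimality of \<open>x (k + 1)\<close> yields an explicit subgradient of \<open>f\<close> there. The strong convexity
  inequality at this subgradient is applied with weight \<open>\<tau> k\<close> towards \<open>x'\<close> and weight \<open>1 - \<tau> k\<close>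
  towards \<open>x k\<close>. The multiplier terms then form an exact difference of squares; for the primal
  terms, the positive semidefinite matrix \<open>E = D - A\<^sup>T A\<close> enters through the polarization identity,
  and its loss from \<open>1 / (\<tau> k)\<^sup>2\<close> to \<open>1 / (\<tau> (k + 1))\<^sup>2\<close> is paid for by strong convexity.
  At a saddle point the inequality telescopes, and the weights
  \<open>(1 - \<tau> k) / (\<tau> k)\<^sup>3 = 1 / (\<tau> k * (\<tau> (k - 1))\<^sup>2)\<close> grow at least like \<open>k\<^sup>3\<close>, because
  \<open>1 / \<tau> k\<close> increases by at least \<open>1 / 2\<close> in every step.
\<close>

section \<open>Subgradients from optimality, and gradients of the subproblem terms\<close>

text \<open>If the subgradient inequality failed at some \<open>y\<close>, a short move from
  \<open>x\<close> towards \<open>y\<close> would lower \<open>f + h\<close>: convexity bounds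
  \<open>f\<close> by its chord, and \<open>h\<close> changes to first order by
  \<open>g\<close>.\<close>

lemma neg_gradient_in_subdifferential_at_arg_min:
  assumes conv: "convex_on UNIV f"
    and min: "is_arg_min (\<lambda>y. f y + h y) (\<lambda>y. True) x"
    and h: "GDERIV h x :> g"
  shows "- g \<in> subdifferential f x"
proof -
  have "f x + (- g) \<bullet> (y - x) \<le> f y" for y
  proof (rule ccontr)
    assume "\<not> ?thesis"
    then have neg: "f y - f x + g \<bullet> (y - x) < 0" by simp
    \<comment> \<open>Replacing \<open>f\<close> by its chord gives a function that is
      differentiable at 0 even if \<open>f\<close> has a kink at \<open>x\<close>; for
      \<open>s\<close> in [0, 1], \<open>\<psi> s - \<psi> 0\<close> bounds the change of
      \<open>f + h\<close> from above.\<close>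
    define \<psi> where "\<psi> s = s * (f y - f x) + h (x + s *\<^sub>R (y - x))" for s :: real
    have "(\<lambda>v. v \<bullet> g) = (\<bullet>) g" by (simp add: fun_eq_iff inner_commute)
    then have "(h has_derivative (\<bullet>) g) (at (x + 0 *\<^sub>R (y - x)))"
      using h by (simp add: gderiv_def)
    moreover have "((\<lambda>s::real. x + s *\<^sub>R (y - x)) has_derivative (\<lambda>s. s *\<^sub>R (y - x))) (at 0)"
      by (auto intro!: derivative_eq_intros)
    ultimately have "((\<lambda>s::real. h (x + s *\<^sub>R (y - x))) has_derivative
        (\<lambda>s. g \<bullet> (s *\<^sub>R (y - x)))) (at 0)"
      by (rule has_derivative_compose[rotated])
    moreover have "(\<lambda>s. g \<bullet> (s *\<^sub>R (y - x))) = (*) (g \<bullet> (y - x))"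
      by (simp add: fun_eq_iff)
    ultimately have "((\<lambda>s::real. h (x + s *\<^sub>R (y - x))) has_real_derivative g \<bullet> (y - x)) (at 0)"
      by (simp only: has_field_derivative_def)
    then have "(\<psi> has_real_derivative (f y - f x + g \<bullet> (y - x))) (at 0)"
      unfolding \<psi>_def by (auto intro!: derivative_eq_intros)
    from DERIV_neg_dec_right[OF this neg] obtain \<delta> where
      "\<delta> > 0" and dec: "\<And>s. 0 < s \<Longrightarrow> s < \<delta> \<Longrightarrow> \<psi> s < \<psi> 0" by auto
    define s where "s = min 1 (\<delta> / 2)"
    have s: "0 < s" "s \<le> 1" "s < \<delta>" using \<open>\<delta> > 0\<close> by (auto simp: s_def)
    have "f x + h x \<le> f (x + s *\<^sub>R (y - x)) + h (x + s *\<^sub>R (y - x))"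
      using min by (auto simp: is_arg_min_linorder)
    moreover have "f (x + s *\<^sub>R (y - x)) \<le> (1 - s) * f x + s * f y"
      using convex_onD[OF conv, of s x y] s by (simp add: algebra_simps)
    ultimately have "\<psi> 0 \<le> \<psi> s"
      by (simp add: \<psi>_def algebra_simps)
    with dec[OF s(1,3)] show False by simp
  qed
  then show ?thesis by (simp add: subdifferential_def)
qed

lemma inner_transpose_matrix_vector:
  fixes A :: "real^'n^'l"
  shows "(transpose A *v y) \<bullet> x = y \<bullet> (A *v x)"
  by (simp add: transpose_matrix_vector dot_lmul_matrix)

lemma GDERIV_phi:
  "GDERIV (\<lambda>z. phi A b c z l) x :> transpose A *v (c *\<^sub>R (A *v x - b) - l)"
proof -
  have "v \<bullet> (transpose A *v y) = y \<bullet> (A *v v)" for v y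
    using inner_transpose_matrix_vector[of A y v] by (simp add: inner_commute)
  then show ?thesis
    unfolding gderiv_def phi_def power2_norm_eq_inner
    by (auto intro!: derivative_eq_intros bounded_linear.has_derivative[OF matrix_vector_mul_bounded_linear]
      simp del: transpose_matrix_vector simp: inner_diff_left inner_diff_right inner_commute algebra_simps)
qed

text \<open>Needed to evaluate the definite description in \<open>gradient\<close>.\<close>

lemma GDERIV_unique_euclidean:
  fixes x :: "'a::euclidean_space"
  assumes "GDERIV h x :> g" "GDERIV h x :> g'"
  shows "g = g'"
  using has_derivative_unique[OF assms[unfolded gderiv_def]] by (metis vector_eq_ldot)

lemma gradient_phi:
  "gradient (\<lambda>z. phi A b c z l) x = transpose A *v (c *\<^sub>R (A *v x - b) - l)"
  unfolding gradient_def by (intro the_equality GDERIV_phi GDERIV_unique_euclidean[OF _ GDERIV_phi])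

text \<open>Symmetry of \<open>D\<close> merges the two terms of the product rule, whence the factor
  2.\<close>

lemma GDERIV_sqnorm_mat:
  assumes "transpose D = D"
  shows "GDERIV (\<lambda>y. sqnorm_mat D (y - c)) x :> 2 *\<^sub>R (D *v (x - c))"
proof -
  have "u \<bullet> (D *v v) = v \<bullet> (D *v u)" for u v
    using inner_transpose_matrix_vector[of D u v] assms by (simp add: inner_commute)
  then show ?thesis
    unfolding gderiv_def sqnorm_mat_def
    by (auto intro!: derivative_eq_intros bounded_linear.has_derivative[OF matrix_vector_mul_bounded_linear])
qed

lemma GDERIV_norm_diff_square:
  fixes x :: "'a::real_inner"
  shows "GDERIV (\<lambda>y. (norm (y - c))\<^sup>2) x :> 2 *\<^sub>R (x - c)"
  unfolding gderiv_def power2_norm_eq_inner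
  by (auto intro!: derivative_eq_intros simp: inner_commute)

section \<open>Quadratic forms of block and Gram matrices\<close>

lemma sqnorm_mat_block_diag_stack:
  "sqnorm_mat (block_diag P Q) (stack x y - stack x' y') = sqnorm_mat P (x - x') + sqnorm_mat Q (y - y')"
proof -
  have UNIV_sum: "(\<Sum>i\<in>UNIV. h i) = (\<Sum>a\<in>UNIV. h (Inl a)) + (\<Sum>c\<in>UNIV. h (Inr c))"
    for h :: "'n::finite + 'l::finite \<Rightarrow> real"
    by (subst UNIV_Plus_UNIV[symmetric], subst sum.Plus) auto
  show ?thesis
    by (simp add: sqnorm_mat_def inner_vec_def matrix_vector_mult_def block_diag_def stack_def UNIV_sum)
qed

lemma sqnorm_mat_scaleR: "sqnorm_mat (c *\<^sub>R E) w = c * sqnorm_mat E w"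
  by (simp add: sqnorm_mat_def scaleR_matrix_vector_assoc[symmetric])

lemma sqnorm_mat_1: "sqnorm_mat (mat 1) w = (norm w)\<^sup>2"
  by (simp add: sqnorm_mat_def power2_norm_eq_inner)

text \<open>Decouples the primal part, governed by \<open>D - transpose A ** A\<close>, from the
  multiplier part; the two are estimated separately below.\<close>

lemma sqnorm_H0:
  "sqnorm_mat (H0 A D \<beta> \<gamma> \<tau> k) (stack y m - stack x' l) =
    \<beta> / (\<tau> k)\<^sup>2 * sqnorm_mat (D - transpose A ** A) (y - x') + (norm (m - l))\<^sup>2 / (\<gamma> * \<beta>)"
  by (simp add: H0_def sqnorm_mat_block_diag_stack sqnorm_mat_scaleR sqnorm_mat_1)

lemma sqnorm_mat_gram: "sqnorm_mat (transpose A ** A) w = (norm (A *v w))\<^sup>2"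
  using inner_transpose_matrix_vector[of A "A *v w" w]
  by (simp add: sqnorm_mat_def matrix_vector_mul_assoc inner_commute power2_norm_eq_inner)

lemma sqnorm_mat_diff: "sqnorm_mat (D - E) w = sqnorm_mat D w - sqnorm_mat E w"
  by (simp add: sqnorm_mat_def matrix_vector_mult_diff_rdistrib inner_diff_right)

text \<open>With \<open>sqnorm_mat_gram\<close> this makes \<open>D - transpose A ** A\<close>
  positive semidefinite for the spectral choice of \<open>D\<close>.\<close>

lemma norm_matrix_vector_le_spectral_norm:
  "(norm (A *v w))\<^sup>2 \<le> (spectral_norm A)\<^sup>2 * (norm w)\<^sup>2"
  unfolding spectral_norm_def power_mult_distrib[symmetric]
  by (intro power_mono onorm matrix_vector_mul_bounded_linear norm_ge_zero)

section \<open>Algebra of one iteration\<close>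

text \<open>Here \<open>r\<close> and \<open>p\<close> are the residuals at the old iterate and at
  the new barred iterate, so the new residual is \<open>(1 - t) *\<^sub>R r + t *\<^sub>R p\<close>.
  The penalty difference cancels the cross term \<open>r \<bullet> p\<close> and leaves the share
  \<gamma>/2 of the square of \<open>p\<close>, which is exactly what completes the square for a
  multiplier step of length \<gamma> \<beta> / t.\<close>

lemma multiplier_part:
  fixes p r m l :: "'a::real_inner"
  assumes "t > 0" "\<gamma> > 0" "\<beta> > 0"
  shows "((l - m) \<bullet> p + (2 - \<gamma>) * (1 - t) * (\<beta> / t\<^sup>2) * (r \<bullet> p) + \<beta> / t * (norm p)\<^sup>2) / t
      - (2 - \<gamma>) * \<beta> / (2 * t ^ 4) * ((norm ((1 - t) *\<^sub>R r + t *\<^sub>R p))\<^sup>2 - (1 - t)\<^sup>2 * (norm r)\<^sup>2)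
    = ((norm (m - (\<gamma> * t * (\<beta> / t\<^sup>2)) *\<^sub>R p - l))\<^sup>2 - (norm (m - l))\<^sup>2) / (2 * \<gamma> * \<beta>)"
proof -
  have e1: "(norm ((1 - t) *\<^sub>R r + t *\<^sub>R p))\<^sup>2 - (1 - t)\<^sup>2 * (norm r)\<^sup>2
      = 2 * t * (1 - t) * (r \<bullet> p) + t\<^sup>2 * (norm p)\<^sup>2"
    unfolding power2_norm_eq_inner
    by (simp add: inner_simps inner_commute power2_eq_square algebra_simps)
  define c where "c = \<gamma> * t * (\<beta> / t\<^sup>2)"
  have e2: "(norm (m - c *\<^sub>R p - l))\<^sup>2 - (norm (m - l))\<^sup>2 = 2 * c * ((l - m) \<bullet> p) + c\<^sup>2 * (norm p)\<^sup>2"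
    unfolding power2_norm_eq_inner
    by (simp add: inner_simps inner_commute power2_eq_square algebra_simps)
  have c: "c = \<gamma> * \<beta> / t" using assms by (simp add: c_def power2_eq_square)
  have "h / (2 * t ^ 4) * (2 * t * q * u + t\<^sup>2 * n) = h * q / t ^ 3 * u + h / (2 * t\<^sup>2) * n" for h q u n :: real
    using assms(1) by (simp add: distrib_left power2_eq_square power3_eq_cube power4_eq_xxxx)
  then have "(2 - \<gamma>) * \<beta> / (2 * t ^ 4) * (2 * t * (1 - t) * (r \<bullet> p) + t\<^sup>2 * (norm p)\<^sup>2)
      = (2 - \<gamma>) * \<beta> * (1 - t) / t ^ 3 * (r \<bullet> p) + (2 - \<gamma>) * \<beta> / (2 * t\<^sup>2) * (norm p)\<^sup>2" .
  moreover have "((l - m) \<bullet> p + (2 - \<gamma>) * (1 - t) * (\<beta> / t\<^sup>2) * (r \<bullet> p) + \<beta> / t * (norm p)\<^sup>2) / t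
      = (l - m) \<bullet> p / t + (2 - \<gamma>) * \<beta> * (1 - t) / t ^ 3 * (r \<bullet> p) + \<beta> / t\<^sup>2 * (norm p)\<^sup>2"
    by (simp add: add_divide_distrib power2_eq_square power3_eq_cube)
  moreover have "(2 * c * ((l - m) \<bullet> p) + c\<^sup>2 * (norm p)\<^sup>2) / (2 * \<gamma> * \<beta>)
      = (l - m) \<bullet> p / t + \<gamma> * \<beta> / (2 * t\<^sup>2) * (norm p)\<^sup>2"
    using assms unfolding c by (simp add: add_divide_distrib power2_eq_square)
  moreover have "(2 - \<gamma>) * \<beta> / (2 * t\<^sup>2) * (norm p)\<^sup>2 + \<gamma> * \<beta> / (2 * t\<^sup>2) * (norm p)\<^sup>2
      = \<beta> / t\<^sup>2 * (norm p)\<^sup>2"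
    by (simp add: distrib_right[symmetric] add_divide_distrib[symmetric])
  ultimately show ?thesis
    unfolding e1 c_def[symmetric] e2 by linarith
qed

text \<open>\<open>P\<close> stands for the next value of 1 / t^2. Polarization produces the two
  \<open>E\<close>-terms and a nonnegative rest; \<open>slack\<close> pays for raising the weight of
  the first one to \<open>P\<close>, and strong convexity leaves the square of
  \<open>x1 - x0\<close>.\<close>

lemma primal_part:
  fixes E :: "real^'n^'n"
  assumes "t > 0" "\<beta> > 0" "transpose E = E" and psd: "\<And>w. sqnorm_mat E w \<ge> 0"
    and slack: "\<beta> * (1 / t\<^sup>2 - P) * sqnorm_mat E (z1 - x') + \<sigma> / t * (norm (z1 - x'))\<^sup>2 \<ge> 0"
    and x1: "x1 = (1 - t) *\<^sub>R x0 + t *\<^sub>R z1"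
  shows "(\<beta> * ((E *v (z1 - z0)) \<bullet> (z1 - x')) + \<sigma> * (1 - t) * ((x1 - x0) \<bullet> (z1 - x'))
        + \<sigma> / 2 * (t * (norm (x' - x1))\<^sup>2 + (1 - t) * (norm (x0 - x1))\<^sup>2)) / t\<^sup>2
    \<ge> 1 / 2 * (\<beta> * P * sqnorm_mat E (z1 - x') - \<beta> / t\<^sup>2 * sqnorm_mat E (z0 - x')
        + \<sigma> * ((1 - t) / t ^ 3) * (norm (x1 - x0))\<^sup>2)" (is "?L \<ge> ?R")
proof -
  have sym: "u \<bullet> (E *v v) = v \<bullet> (E *v u)" for u v
    using inner_transpose_matrix_vector[of E u v] assms by (simp add: inner_commute)
  define w where "w = z1 - x'"
  define d where "d = x1 - x0"
  have polar: "(E *v (z1 - z0)) \<bullet> w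
      = (sqnorm_mat E w - sqnorm_mat E (z0 - x') + sqnorm_mat E (z1 - z0)) / 2"
    unfolding sqnorm_mat_def w_def
    by (simp add: matrix_vector_mult_diff_distrib inner_diff_left inner_diff_right
        inner_commute[of "E *v _"] sym[of z0 z1] sym[of x' z1] sym[of x' z0])
  \<comment> \<open>Eliminates \<open>x0\<close> in favour of \<open>d\<close> and \<open>w\<close>;
    the factor \<open>t\<close> avoids a division.\<close>
  have x1w: "t *\<^sub>R (x' - x1) = (1 - t) *\<^sub>R d - t *\<^sub>R w"
    unfolding w_def d_def x1 by (simp add: algebra_simps)
  have "t\<^sup>2 * (norm (x' - x1))\<^sup>2 = (norm (t *\<^sub>R (x' - x1)))\<^sup>2"
    by (simp add: power_mult_distrib)
  also have "\<dots> = (1 - t)\<^sup>2 * (norm d)\<^sup>2 - 2 * t * (1 - t) * (d \<bullet> w) + t\<^sup>2 * (norm w)\<^sup>2"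
    unfolding x1w power2_norm_eq_inner
    by (simp add: inner_simps inner_commute power2_eq_square algebra_simps)
  finally have n1: "(norm (x' - x1))\<^sup>2
      = ((1 - t)\<^sup>2 * (norm d)\<^sup>2 - 2 * t * (1 - t) * (d \<bullet> w) + t\<^sup>2 * (norm w)\<^sup>2) / t\<^sup>2"
    using assms(1) by (simp add: field_simps)
  have n2: "norm (x0 - x1) = norm d" by (simp add: d_def norm_minus_commute)
  \<comment> \<open>The mixed term here cancels the inner product
    \<open>\<sigma> * (1 - t) * (d \<bullet> w)\<close> that comes from the proximal term around
    \<open>x0\<close>.\<close>
  have sq: "t * (norm (x' - x1))\<^sup>2 + (1 - t) * (norm (x0 - x1))\<^sup>2
      = t * (norm w)\<^sup>2 - 2 * (1 - t) * (d \<bullet> w) + (1 - t) / t * (norm d)\<^sup>2"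
  proof -
    have "t * (norm (x' - x1))\<^sup>2
        = (1 - t)\<^sup>2 / t * (norm d)\<^sup>2 - 2 * (1 - t) * (d \<bullet> w) + t * (norm w)\<^sup>2"
      unfolding n1 using assms(1)
      by (simp add: add_divide_distrib diff_divide_distrib ring_distribs power2_eq_square)
    moreover have "(1 - t)\<^sup>2 / t * (norm d)\<^sup>2 + (1 - t) * (norm d)\<^sup>2 = (1 - t) / t * (norm d)\<^sup>2"
    proof -
      have "(1 - t)\<^sup>2 / t + (1 - t) = (1 - t) / t"
        using assms(1) by (simp add: field_simps power2_eq_square)
      then show ?thesis by (metis distrib_right)
    qed
    ultimately show ?thesis unfolding n2 by linarith
  qed
  define e where "e = sqnorm_mat E w"
  define e0 where "e0 = sqnorm_mat E (z0 - x')"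
  define e1 where "e1 = sqnorm_mat E (z1 - z0)"
  have "(\<beta> * ((e - e0 + e1) / 2) + \<sigma> * (1 - t) * (d \<bullet> w)
      + \<sigma> / 2 * (t * (norm w)\<^sup>2 - 2 * (1 - t) * (d \<bullet> w) + (1 - t) / t * (norm d)\<^sup>2)) / t\<^sup>2
    = (\<beta> / 2 * (e - e0 + e1) + \<sigma> / 2 * t * (norm w)\<^sup>2 + \<sigma> / 2 * ((1 - t) / t) * (norm d)\<^sup>2) / t\<^sup>2"
  proof -
    have "\<sigma> / 2 * (t * n - 2 * (1 - t) * u + c * n') = \<sigma> / 2 * t * n - \<sigma> * (1 - t) * u + \<sigma> / 2 * c * n'"
      for n u n' c by (simp add: algebra_simps)
    then have "\<beta> * ((e - e0 + e1) / 2) + \<sigma> * (1 - t) * (d \<bullet> w)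
        + \<sigma> / 2 * (t * (norm w)\<^sup>2 - 2 * (1 - t) * (d \<bullet> w) + (1 - t) / t * (norm d)\<^sup>2)
      = \<beta> / 2 * (e - e0 + e1) + \<sigma> / 2 * t * (norm w)\<^sup>2 + \<sigma> / 2 * ((1 - t) / t) * (norm d)\<^sup>2"
      by (simp only:)
    then show ?thesis by (simp only:)
  qed
  also have "\<dots> = \<beta> / 2 * (1 / t\<^sup>2) * (e - e0 + e1) + \<sigma> / 2 * (1 / t) * (norm w)\<^sup>2
      + \<sigma> / 2 * ((1 - t) / t ^ 3) * (norm d)\<^sup>2"
    using assms(1) by (simp add: add_divide_distrib power2_eq_square power3_eq_cube)
  finally have L: "?L = \<beta> / 2 * (1 / t\<^sup>2) * (e - e0 + e1) + \<sigma> / 2 * (1 / t) * (norm w)\<^sup>2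
      + \<sigma> / 2 * ((1 - t) / t ^ 3) * (norm d)\<^sup>2"
    unfolding sq d_def[symmetric] w_def[symmetric] polar e_def e0_def e1_def .
  \<comment> \<open>What remains is half of \<open>slack\<close> plus the nonnegative rest of the
    polarization.\<close>
  have "?L - ?R = (\<beta> * (1 / t\<^sup>2 - P) * e + \<sigma> / t * (norm w)\<^sup>2) / 2 + \<beta> / (2 * t\<^sup>2) * e1"
    unfolding L unfolding d_def[symmetric] w_def[symmetric] e_def[symmetric] e0_def[symmetric]
    by (simp add: ring_distribs add_divide_distrib diff_divide_distrib)
  also have "\<dots> \<ge> 0"
    using slack psd[of "z1 - z0"] assms(1,2) unfolding w_def e_def e1_def by (intro add_nonneg_nonneg) auto
  finally show ?thesis by simp
qed

text \<open>Both strong convexity inequalities use the same subgradient at \<open>x1\<close>, so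
  their weighted sum has a single linear term.\<close>

lemma strongly_convex_combination:
  assumes "strongly_convex \<sigma> f" "g \<in> subdifferential f x1" "0 \<le> t" "t \<le> 1"
  shows "t * f y + (1 - t) * f z - f x1 \<ge> g \<bullet> (t *\<^sub>R y + (1 - t) *\<^sub>R z - x1)
    + \<sigma> / 2 * (t * (norm (y - x1))\<^sup>2 + (1 - t) * (norm (z - x1))\<^sup>2)"
proof -
  have sc: "f u \<ge> f x1 + g \<bullet> (u - x1) + \<sigma> / 2 * (norm (u - x1))\<^sup>2" for u
    using assms(1,2) unfolding strongly_convex_def by blast
  have "t * f y + (1 - t) * f z
      \<ge> t * (f x1 + g \<bullet> (y - x1) + \<sigma> / 2 * (norm (y - x1))\<^sup>2)
        + (1 - t) * (f x1 + g \<bullet> (z - x1) + \<sigma> / 2 * (norm (z - x1))\<^sup>2)"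
    using sc[of y] sc[of z] assms(3,4) by (intro add_mono mult_left_mono) auto
  then show ?thesis
    by (simp add: inner_simps algebra_simps diff_divide_distrib)
qed

text \<open>
  One iteration, with \<open>x0\<close>, \<open>x1\<close> for the old and new iterate, \<open>z0\<close>, \<open>z1\<close> for their barred versions
  and \<open>m\<close> for the barred multiplier.
\<close>

lemma one_step:
  fixes A :: "real^'n^'l" and D :: "real^'n^'n" and t :: real
  defines "E \<equiv> D - transpose A ** A"
  assumes f: "strongly_convex \<sigma> f"
    and t: "0 < t" "t \<le> 1" and pos: "\<gamma> > 0" "\<beta> > 0"
    and E: "transpose E = E" "\<And>w. sqnorm_mat E w \<ge> 0"
    and slack: "\<beta> * (1 / t\<^sup>2 - P) * sqnorm_mat E (z1 - x') + \<sigma> / t * (norm (z1 - x'))\<^sup>2 \<ge> 0"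
    and x1: "x1 = (1 - t) *\<^sub>R x0 + t *\<^sub>R z1"
    and xh: "xh = (1 - t) *\<^sub>R x0 + t *\<^sub>R z0"
    and x': "A *v x' = b"
    and lh: "lh = m + (\<gamma> * (1 - t) * (\<beta> / t\<^sup>2)) *\<^sub>R (A *v x0 - b) - ((1 - t) * (\<beta> / t\<^sup>2)) *\<^sub>R (A *v x0 - b)"
    and m1: "m1 = m - (\<gamma> * t * (\<beta> / t\<^sup>2)) *\<^sub>R (A *v z1 - b)"
    and sub: "- (transpose A *v ((\<beta> / t\<^sup>2) *\<^sub>R (A *v xh - b) - lh)
        + (\<beta> / t\<^sup>2) *\<^sub>R (D *v (x1 - xh)) + (\<sigma> * (1 - t) / t) *\<^sub>R (x1 - x0)) \<in> subdifferential f x1"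
  shows "1 / t\<^sup>2 * (f x' - f x1 + l \<bullet> (A *v x1 - b) - (2 - \<gamma>) * \<beta> / (2 * t\<^sup>2) * (norm (A *v x1 - b))\<^sup>2)
      - ((1 - t) / t\<^sup>2) * (f x' - f x0 + l \<bullet> (A *v x0 - b)
          - (2 - \<gamma>) * \<beta> / 2 * ((1 - t) / t\<^sup>2) * (norm (A *v x0 - b))\<^sup>2)
    \<ge> 1 / 2 * (\<beta> * P * sqnorm_mat E (z1 - x') + (norm (m1 - l))\<^sup>2 / (\<gamma> * \<beta>)
        - (\<beta> / t\<^sup>2 * sqnorm_mat E (z0 - x') + (norm (m - l))\<^sup>2 / (\<gamma> * \<beta>))
        + \<sigma> * ((1 - t) / t ^ 3) * (norm (x1 - x0))\<^sup>2)" (is "?L \<ge> ?R")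
proof -
  define p where "p = A *v z1 - b"
  define r where "r = A *v x0 - b"
  define B where "B = \<beta> / t\<^sup>2"
  define w where "w = z1 - x'"
  define g where "g = - (transpose A *v (B *\<^sub>R (A *v xh - b) - lh)
        + B *\<^sub>R (D *v (x1 - xh)) + (\<sigma> * (1 - t) / t) *\<^sub>R (x1 - x0))"
  have s: "A *v x1 - b = (1 - t) *\<^sub>R r + t *\<^sub>R p"
    unfolding x1 r_def p_def
    by (simp add: matrix_vector_right_distrib matrix_vector_mult_scaleR algebra_simps)
  have Aw: "A *v w = p" by (simp add: w_def p_def matrix_vector_mult_diff_distrib x')
  \<comment> \<open>The Gram part of \<open>D\<close> shifts the penalty gradient from
    \<open>xh\<close> to \<open>x1\<close>, so in \<open>inner_g\<close> only \<open>E\<close> still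
    acts on \<open>z1 - z0\<close>.\<close>
  have Dsplit: "D *v u = E *v u + transpose A *v (A *v u)" for u
    by (simp add: E_def matrix_vector_mult_diff_rdistrib matrix_vector_mul_assoc)
  have xx: "x1 - xh = t *\<^sub>R (z1 - z0)" unfolding x1 xh by (simp add: algebra_simps)
  have inner_g: "g \<bullet> w = (lh - B *\<^sub>R (A *v x1 - b)) \<bullet> p - B * t * ((E *v (z1 - z0)) \<bullet> w)
      - \<sigma> * (1 - t) / t * ((x1 - x0) \<bullet> w)"
  proof -
    define e where "e = (E *v (z1 - z0)) \<bullet> w"
    have "(E *v (x1 - xh)) \<bullet> w = t * e"
      unfolding xx e_def by (simp add: matrix_vector_mult_scaleR)
    then show ?thesis
      unfolding g_def Dsplit e_def[symmetric]
        inner_minus_left inner_add_left inner_scaleR_left inner_transpose_matrix_vector Aw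
      by (simp add: inner_diff_left matrix_vector_mult_diff_distrib[of A] ring_distribs)
  qed
  \<comment> \<open>With the weights \<open>t\<close> and \<open>1 - t\<close> the linear term
    points along \<open>w\<close>, where \<open>inner_g\<close> evaluates it.\<close>
  have comb: "t *\<^sub>R x' + (1 - t) *\<^sub>R x0 - x1 = - (t *\<^sub>R w)"
    unfolding x1 w_def by (simp add: algebra_simps)
  have sc: "t * f x' + (1 - t) * f x0 - f x1 \<ge> - t * (g \<bullet> w)
      + \<sigma> / 2 * (t * (norm (x' - x1))\<^sup>2 + (1 - t) * (norm (x0 - x1))\<^sup>2)"
    using strongly_convex_combination[OF f sub, of t x' x0] t
    unfolding comb B_def[symmetric] g_def[symmetric] by simp
  define X where "X = \<beta> * ((E *v (z1 - z0)) \<bullet> w) + \<sigma> * (1 - t) * ((x1 - x0) \<bullet> w)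
        + \<sigma> / 2 * (t * (norm (x' - x1))\<^sup>2 + (1 - t) * (norm (x0 - x1))\<^sup>2)"
  define M where "M = (l - m) \<bullet> p + (2 - \<gamma>) * (1 - t) * B * (r \<bullet> p) + \<beta> / t * (norm p)\<^sup>2"
  have Bt: "B * t * t = \<beta>" "B * t = \<beta> / t" using t by (auto simp: B_def power2_eq_square)
  \<comment> \<open>The residual \<open>r\<close> has coefficient
    \<open>(\<gamma> - 1) * (1 - t) * B\<close> in \<open>lh\<close> and loses another
    \<open>(1 - t) * B\<close> through \<open>x1\<close>, whence the factor
    \<open>2 - \<gamma>\<close>.\<close>
  have lhp: "(lh - B *\<^sub>R (A *v x1 - b)) \<bullet> p
      = m \<bullet> p - (2 - \<gamma>) * (1 - t) * B * (r \<bullet> p) - \<beta> / t * (norm p)\<^sup>2"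
    unfolding lh s r_def[symmetric] B_def[symmetric] Bt(2)[symmetric]
      power2_norm_eq_inner inner_add_left inner_diff_left inner_scaleR_left
    by (simp add: algebra_simps)
  have "- t * (g \<bullet> w) = t * (M - l \<bullet> p) + \<beta> * ((E *v (z1 - z0)) \<bullet> w) + \<sigma> * (1 - t) * ((x1 - x0) \<bullet> w)"
  proof -
    define q where "q = \<sigma> * (1 - t) / t"
    have "- t * (g \<bullet> w) = t * (M - l \<bullet> p) + (B * t * t) * ((E *v (z1 - z0)) \<bullet> w)
        + (t * q) * ((x1 - x0) \<bullet> w)"
      unfolding inner_g lhp M_def q_def[symmetric] by (simp add: inner_diff_left algebra_simps)
    then show ?thesis unfolding Bt q_def using t by simp
  qed
  with sc have fX: "t * f x' + (1 - t) * f x0 - f x1 + t * (l \<bullet> p) \<ge> t * M + X"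
    unfolding X_def by (simp add: algebra_simps)
  \<comment> \<open>The multiplier terms combine to \<open>t * (l \<bullet> p)\<close>. The old
    penalty carries (1 - t) / t^2 twice, which gives the square of \<open>1 - t\<close> over
    t^4.\<close>
  have "?L = (t * f x' + (1 - t) * f x0 - f x1 + t * (l \<bullet> p)) / t\<^sup>2
      - (2 - \<gamma>) * \<beta> / (2 * t ^ 4) * ((norm ((1 - t) *\<^sub>R r + t *\<^sub>R p))\<^sup>2 - (1 - t)\<^sup>2 * (norm r)\<^sup>2)"
  proof -
    define a where "a = 1 / t\<^sup>2"
    define h where "h = (2 - \<gamma>) * \<beta> / 2"
    have pen: "(2 - \<gamma>) * \<beta> / 2 = h" "(2 - \<gamma>) * \<beta> / (2 * t\<^sup>2) = h * a"
      "(2 - \<gamma>) * \<beta> / (2 * t ^ 4) = h * a * a"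
      by (simp_all add: h_def a_def power2_eq_square power4_eq_xxxx)
    have quot: "u / t\<^sup>2 = u * a" for u
      by (simp add: a_def)
    show ?thesis
      unfolding s r_def[symmetric] inner_add_right inner_scaleR_right pen quot
      by (simp add: algebra_simps power2_eq_square)
  qed
  also have "\<dots> \<ge> (t * M + X) / t\<^sup>2
      - (2 - \<gamma>) * \<beta> / (2 * t ^ 4) * ((norm ((1 - t) *\<^sub>R r + t *\<^sub>R p))\<^sup>2 - (1 - t)\<^sup>2 * (norm r)\<^sup>2)"
    using fX by (intro diff_right_mono divide_right_mono) auto
  also have "(t * M + X) / t\<^sup>2 = M / t + X / t\<^sup>2"
    using t by (simp add: field_simps power2_eq_square)
  also have "M / t + X / t\<^sup>2
      - (2 - \<gamma>) * \<beta> / (2 * t ^ 4) * ((norm ((1 - t) *\<^sub>R r + t *\<^sub>R p))\<^sup>2 - (1 - t)\<^sup>2 * (norm r)\<^sup>2)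
    = ((norm (m1 - l))\<^sup>2 - (norm (m - l))\<^sup>2) / (2 * \<gamma> * \<beta>) + X / t\<^sup>2"
    using multiplier_part[OF t(1) pos, of l m p r]
    unfolding M_def B_def m1 p_def[symmetric] by linarith
  finally have L: "?L \<ge> ((norm (m1 - l))\<^sup>2 - (norm (m - l))\<^sup>2) / (2 * \<gamma> * \<beta>) + X / t\<^sup>2" .
  have "X / t\<^sup>2 \<ge> 1 / 2 * (\<beta> * P * sqnorm_mat E w - \<beta> / t\<^sup>2 * sqnorm_mat E (z0 - x')
        + \<sigma> * ((1 - t) / t ^ 3) * (norm (x1 - x0))\<^sup>2)"
    using primal_part[OF t(1) pos(2) E slack x1] unfolding X_def w_def .
  moreover have "((norm (m1 - l))\<^sup>2 - (norm (m - l))\<^sup>2) / (2 * \<gamma> * \<beta>)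
      = 1 / 2 * ((norm (m1 - l))\<^sup>2 / (\<gamma> * \<beta>) - (norm (m - l))\<^sup>2 / (\<gamma> * \<beta>))"
    using pos by (simp add: field_simps)
  ultimately show ?thesis using L unfolding w_def by (simp add: algebra_simps)
qed

section \<open>Growth of the weights and the rate it implies\<close>

text \<open>Consecutive reciprocals satisfy a^2 = a' (a' - 1), that is (a' - 1/2)^2 = a^2 + 1/4, so
  a' \<ge> a + 1/2. The induction starts at index -1, where the reciprocal exceeds 1.\<close>

lemma inverse_tau_growth:
  fixes \<tau> :: "int \<Rightarrow> real"
  assumes init: "0 < \<tau> (-1)" "\<tau> (-1) < 1"
    and pos: "\<And>k. k \<ge> 0 \<Longrightarrow> \<tau> k > 0"
    and rec: "\<And>k. k \<ge> 0 \<Longrightarrow> 1 / (\<tau> (k - 1))\<^sup>2 = (1 - \<tau> k) / (\<tau> k)\<^sup>2"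
  shows "1 / \<tau> (int n - 1) \<ge> (real n + 2) / 2"
proof (induction n)
  case 0
  then show ?case using init by (simp add: field_simps)
next
  case (Suc n)
  define a where "a = 1 / \<tau> (int n - 1)"
  define a' where "a' = 1 / \<tau> (int n)"
  have t: "\<tau> (int n) > 0" using pos by simp
  have "a\<^sup>2 = a' * (a' - 1)"
    using rec[of "int n"] t unfolding a_def a'_def by (simp add: field_simps power2_eq_square)
  then have sq: "(a' - 1 / 2)\<^sup>2 = a\<^sup>2 + 1 / 4" by (simp add: power2_eq_square algebra_simps)
  have "(real n + 2) / 2 \<le> a" using Suc unfolding a_def .
  then have "a \<ge> 1" by simp
  moreover have "a' > 0" using t by (simp add: a'_def)
  ultimately have "a' - 1 / 2 \<ge> a"
  proof -
    have "a\<^sup>2 \<le> (a' - 1 / 2)\<^sup>2" using sq by simp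
    \<comment> \<open>The negative root is excluded by \<open>a' > 0\<close> together with
      \<open>a \<ge> 1\<close>.\<close>
    then have "a \<le> \<bar>a' - 1 / 2\<bar>" using \<open>a \<ge> 1\<close> abs_le_square_iff[of a "a' - 1 / 2"] by simp
    then show ?thesis using \<open>a \<ge> 1\<close> \<open>a' > 0\<close> by linarith
  qed
  then show ?case using Suc unfolding a_def a'_def by simp
qed

text \<open>Bounding each \<open>d i\<close> below by the minimum and telescoping,
  \<open>\<Phi> 0\<close> dominates the minimum times the sum of the weights; the first N cubes sum
  to at least N^4 / 4, whence the constant \<open>4 * \<Phi> 0 / c\<close>.\<close>

lemma Min_bigo_of_weighted_decrease:
  fixes d w \<Phi> :: "int \<Rightarrow> real"
  assumes c: "c > 0"
    and d: "\<And>k. d k \<ge> 0"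
    and \<Phi>: "\<And>k. k \<ge> 0 \<Longrightarrow> \<Phi> k \<ge> 0"
    and dec: "\<And>k. k \<ge> 0 \<Longrightarrow> \<Phi> (k + 1) + w k * d k \<le> \<Phi> k"
    and w: "\<And>n. w (int n) \<ge> c * real (Suc n) ^ 3"
  shows "(\<lambda>k::nat. MIN i\<in>{0..int k}. d i) \<in> O(\<lambda>k. 1 / real k ^ 4)"
proof (rule bigoI[where c = "4 * \<Phi> 0 / c"])
  have bound: "real N ^ 4 * (MIN i\<in>{0..int N}. d i) \<le> 4 * \<Phi> 0 / c" for N
  proof -
    define \<mu> where "\<mu> = (MIN i\<in>{0..int N}. d i)"
    have \<mu>: "\<mu> \<le> d i" if "i \<in> {0..int N}" for i
      using that unfolding \<mu>_def by (intro Min_le) auto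
    have \<mu>0: "\<mu> \<ge> 0" unfolding \<mu>_def using d by (subst Min_ge_iff) auto
    \<comment> \<open>The telescoped sum in inductive form: (n + 1)^4 - n^4 \<le> 4 (n + 1)^3 lets
      each weight pay for one increment of n^4 / 4.\<close>
    have "n \<le> N \<Longrightarrow> \<Phi> (int n) + c * \<mu> * real n ^ 4 / 4 \<le> \<Phi> 0" for n
    proof (induction n)
      case 0
      then show ?case by simp
    next
      case (Suc n)
      have "(real n + 1) ^ 4 \<le> real n ^ 4 + 4 * (real n + 1) ^ 3"
        by (simp add: power4_eq_xxxx power3_eq_cube algebra_simps)
      then have "c * \<mu> * (real n + 1) ^ 4 \<le> c * \<mu> * (real n ^ 4 + 4 * (real n + 1) ^ 3)"
        using c \<mu>0 by (intro mult_left_mono) auto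
      moreover have "(c * real (Suc n) ^ 3) * \<mu> \<le> w (int n) * d (int n)"
        using w[of n] c \<mu>0 \<mu>[of "int n"] Suc.prems
        by (intro mult_mono order_trans[OF _ w[of n]]) auto
      ultimately show ?case
        using Suc dec[of "int n"] by (simp add: algebra_simps)
    qed
    from this[of N] \<Phi>[of "int N"] have "c * \<mu> * real N ^ 4 \<le> 4 * \<Phi> 0" by simp
    then show ?thesis unfolding \<mu>_def using c by (simp add: field_simps)
  qed
  have nonneg: "(MIN i\<in>{0..int N}. d i) \<ge> 0" for N
    using d by (subst Min_ge_iff) auto
  \<comment> \<open>At \<open>k = 0\<close> the right-hand side is 0, since division by 0 yields 0;
    hence \<open>k \<ge> 1\<close>.\<close>
  have "norm (MIN i\<in>{0..int k}. d i) \<le> 4 * \<Phi> 0 / c * norm (1 / real k ^ 4)" if "k \<ge> 1" for k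
  proof -
    have "(MIN i\<in>{0..int k}. d i) \<le> 4 * \<Phi> 0 / c / real k ^ 4"
      using bound[of k] that by (subst pos_le_divide_eq) (auto simp: mult.commute)
    then show ?thesis using nonneg[of k] by simp
  qed
  then show "\<forall>\<^sub>F k in sequentially.
      norm (MIN i\<in>{0..int k}. d i) \<le> 4 * \<Phi> 0 / c * norm (1 / real k ^ 4)"
    by (intro eventually_sequentiallyI[of 1])
qed

text \<open>Subtracting the residual from the multiplier raises the Lagrangian by the squared norm
  of the residual, so maximality in the multiplier forces it to vanish.\<close>

lemma saddle_point_feasible:
  assumes "saddle_point f A b xs lams"
  shows "A *v xs = b"
proof -
  have "lagrangian f A b xs (lams - (A *v xs - b)) \<le> lagrangian f A b xs lams"
    using assms unfolding saddle_point_def by blast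
  then have "(A *v xs - b) \<bullet> (A *v xs - b) \<le> 0"
    by (simp add: lagrangian_def inner_diff_left)
  then show ?thesis by (metis eq_iff_diff_eq_0 inner_eq_zero_iff inner_ge_zero order_antisym)
qed

section \<open>The descent inequality and the rate for the generated iterates\<close>

theorem mainTheorem4:
  fixes f :: "real^'n \<Rightarrow> real"
    and A :: "real^'n^'l" and b :: "real^'l" and D :: "real^'n^'n"
    and \<sigma> \<gamma> \<beta> :: real
    and \<tau> :: "int \<Rightarrow> real"
    and x :: "int \<Rightarrow> real^'n" and lam :: "int \<Rightarrow> real^'l"
  assumes f_closed: "closed_fun f"
    and f_proper: "proper_fun (\<lambda>y. ereal (f y))"
    and f_strongly_convex: "strongly_convex \<sigma> f"
    and sigma: "\<sigma> > 0"
    and gamma: "0 < \<gamma>" "\<gamma> \<le> 2"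
    and beta: "\<beta> > 0"
    and tau_init: "0 < \<tau> (-1)" "\<tau> (-1) < 1"
    and tau_pos: "\<And>k. k \<ge> 0 \<Longrightarrow> \<tau> k > 0"
    and tau_rec: "\<And>k. k \<ge> 0 \<Longrightarrow> 1 / (\<tau> (k - 1))\<^sup>2 = (1 - \<tau> k) / (\<tau> k)\<^sup>2"
    and D_choice:
      "D = transpose A ** A \<or>
       (D = (spectral_norm A)\<^sup>2 *\<^sub>R mat 1 \<and>
        (\<forall>k\<ge>0. \<beta> * (spectral_norm A)\<^sup>2 / (\<tau> k)\<^sup>2 + \<sigma> / \<tau> k
                 \<ge> \<beta> * (spectral_norm A)\<^sup>2 / (\<tau> (k + 1))\<^sup>2))"
    and x_step: "\<And>k. k \<ge> 0 \<Longrightarrow>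
      is_arg_min
        (\<lambda>y. f y
            + y \<bullet> gradient (\<lambda>z. phi A b (beta_seq \<beta> \<tau> k) z (lamhat A b \<beta> \<tau> x lam k)) (xhat \<tau> x k)
            + beta_seq \<beta> \<tau> k / 2 * sqnorm_mat D (y - xhat \<tau> x k)
            + \<sigma> * (1 - \<tau> k) / (2 * \<tau> k) * (norm (y - x k))\<^sup>2)
        (\<lambda>y. True)
        (x (k + 1))"
    and lam_step: "\<And>k. k \<ge> 0 \<Longrightarrow>
      lambar A b \<beta> \<gamma> \<tau> x lam (k + 1) =
        lambar A b \<beta> \<gamma> \<tau> x lam k
          - (\<gamma> * \<tau> k * beta_seq \<beta> \<tau> k) *\<^sub>R (A *v xbar \<tau> x (k + 1) - b)"
  shows
    "(\<forall>x' \<in> feasible A b. \<forall>l. \<forall>k\<ge>0.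
        1 / (\<tau> k)\<^sup>2 *
          (S_seq f A b x x' l (k + 1)
            - (2 - \<gamma>) * \<beta> / (2 * (\<tau> k)\<^sup>2) * (norm (A *v xbreve x k - b))\<^sup>2)
        - 1 / (\<tau> (k - 1))\<^sup>2 *
          (S_seq f A b x x' l k
            - (2 - \<gamma>) * \<beta> / (2 * (\<tau> (k - 1))\<^sup>2) * (norm (A *v xbreve x (k - 1) - b))\<^sup>2)
        \<ge> 1 / 2 *
          (sqnorm_mat (H0 A D \<beta> \<gamma> \<tau> (k + 1)) (v_seq A b \<beta> \<gamma> \<tau> x lam (k + 1) - stack x' l)
            - sqnorm_mat (H0 A D \<beta> \<gamma> \<tau> k) (v_seq A b \<beta> \<gamma> \<tau> x lam k - stack x' l)
            + \<sigma> * ((1 - \<tau> k) / (\<tau> k) ^ 3) * (norm (xbreve x k - xbreve x (k - 1)))\<^sup>2))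
     \<and> (\<forall>xs lams. saddle_point f A b xs lams \<longrightarrow>
          (\<lambda>k::nat. MIN i\<in>{0..int k}. (norm (xbreve x i - xbreve x (i - 1)))\<^sup>2)
            \<in> O(\<lambda>k. 1 / real k ^ 4))"
proof -
  define E where "E = D - transpose A ** A"
  have transpose_diff: "transpose (P - Q) = transpose P - transpose Q" for P Q :: "real^'n^'n"
    by (simp add: transpose_def vec_eq_iff)
  have gram_sym: "transpose (transpose A ** A) = transpose A ** A"
    by (simp add: matrix_transpose_mul)
  have D_sym: "transpose D = D"
    using D_choice
  proof
    assume "D = transpose A ** A"
    then show ?thesis using gram_sym by simp
  next
    assume "D = (spectral_norm A)\<^sup>2 *\<^sub>R mat 1 \<and>
       (\<forall>k\<ge>0. \<beta> * (spectral_norm A)\<^sup>2 / (\<tau> k)\<^sup>2 + \<sigma> / \<tau> k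
                 \<ge> \<beta> * (spectral_norm A)\<^sup>2 / (\<tau> (k + 1))\<^sup>2)"
    then show ?thesis by (simp add: transpose_def vec_eq_iff mat_def)
  qed
  have E_sym: "transpose E = E" unfolding E_def transpose_diff D_sym gram_sym ..
  have E_cases: "(E = 0) \<or> ((\<forall>w. sqnorm_mat E w = (spectral_norm A)\<^sup>2 * (norm w)\<^sup>2 - (norm (A *v w))\<^sup>2) \<and>
       (\<forall>k\<ge>0. \<beta> * (spectral_norm A)\<^sup>2 / (\<tau> k)\<^sup>2 + \<sigma> / \<tau> k
                 \<ge> \<beta> * (spectral_norm A)\<^sup>2 / (\<tau> (k + 1))\<^sup>2))"
    using D_choice unfolding E_def
    by (auto simp: sqnorm_mat_diff sqnorm_mat_gram sqnorm_mat_scaleR sqnorm_mat_1)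
  have E_psd: "sqnorm_mat E w \<ge> 0" for w
    using E_cases norm_matrix_vector_le_spectral_norm[of A w] by (auto simp: sqnorm_mat_def)
  \<comment> \<open>The left side of the recursion is nonnegative, which forces
    \<open>1 - \<tau> k \<ge> 0\<close>.\<close>
  have tau_le_1: "\<tau> k \<le> 1" if "k \<ge> 0" for k
  proof -
    have "0 \<le> (1 - \<tau> k) / (\<tau> k)\<^sup>2" using tau_rec[OF that] by (metis zero_le_divide_1_iff zero_le_power2)
    then show ?thesis using tau_pos[OF that] by (auto simp: zero_le_divide_iff)
  qed
  have tau_pos': "\<tau> k > 0" if "k \<ge> -1" for k
    using that tau_init tau_pos by (cases "k = -1") auto
  \<comment> \<open>This is the condition of \<open>one_step\<close>, with the next weight as
    \<open>P\<close>. For the spectral choice of \<open>D\<close>, \<open>sqnorm_mat E w\<close> is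
    at most its first term, and the assumed parameter inequality absorbs that.\<close>
  have slack: "\<beta> * (1 / (\<tau> k)\<^sup>2 - 1 / (\<tau> (k + 1))\<^sup>2) * sqnorm_mat E w + \<sigma> / \<tau> k * (norm w)\<^sup>2 \<ge> 0"
    if k: "k \<ge> 0" for k w
    using E_cases
  proof
    assume "E = 0"
    then show ?thesis using sigma tau_pos[OF k] by (simp add: sqnorm_mat_def)
  next
    assume *: "(\<forall>w. sqnorm_mat E w = (spectral_norm A)\<^sup>2 * (norm w)\<^sup>2 - (norm (A *v w))\<^sup>2) \<and>
       (\<forall>k\<ge>0. \<beta> * (spectral_norm A)\<^sup>2 / (\<tau> k)\<^sup>2 + \<sigma> / \<tau> k
                 \<ge> \<beta> * (spectral_norm A)\<^sup>2 / (\<tau> (k + 1))\<^sup>2)"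
    define c where "c = \<beta> * (1 / (\<tau> (k + 1))\<^sup>2 - 1 / (\<tau> k)\<^sup>2)"
    have "1 / (\<tau> k)\<^sup>2 \<le> 1 / (\<tau> (k + 1))\<^sup>2"
      using tau_rec[of "k + 1"] k tau_pos[of "k + 1"] by (simp add: divide_right_mono)
    then have "c \<ge> 0" using beta by (simp add: c_def)
    then have "c * sqnorm_mat E w \<le> c * ((spectral_norm A)\<^sup>2 * (norm w)\<^sup>2)"
      using * by (intro mult_left_mono) auto
    also have "\<dots> = (c * (spectral_norm A)\<^sup>2) * (norm w)\<^sup>2" by simp
    also have "\<dots> \<le> \<sigma> / \<tau> k * (norm w)\<^sup>2"
    proof (rule mult_right_mono)
      show "c * (spectral_norm A)\<^sup>2 \<le> \<sigma> / \<tau> k"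
        using *[THEN conjunct2, rule_format, OF k] by (simp add: c_def algebra_simps)
    qed simp
    finally show ?thesis by (simp add: c_def algebra_simps)
  qed
  \<comment> \<open>Both brackets of the claim are values of this one sequence, at
    \<open>k + 1\<close> and at \<open>k\<close>, so the inequality telescopes.\<close>
  define G where "G x' l k = 1 / (\<tau> (k - 1))\<^sup>2 *
          (S_seq f A b x x' l k
            - (2 - \<gamma>) * \<beta> / (2 * (\<tau> (k - 1))\<^sup>2) * (norm (A *v xbreve x (k - 1) - b))\<^sup>2)"
    for x' l k
  define V where "V x' l k = sqnorm_mat (H0 A D \<beta> \<gamma> \<tau> k) (v_seq A b \<beta> \<gamma> \<tau> x lam k - stack x' l)"
    for x' l k
  have main: "G x' l (k + 1) - G x' l k \<ge> 1 / 2 * (V x' l (k + 1) - V x' l k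
        + \<sigma> * ((1 - \<tau> k) / (\<tau> k) ^ 3) * (norm (xbreve x k - xbreve x (k - 1)))\<^sup>2)"
    if x': "x' \<in> feasible A b" and k: "k \<ge> 0" for x' l k
  proof -
    define t where "t = \<tau> k"
    define xh where "xh = xhat \<tau> x k"
    define lh where "lh = lamhat A b \<beta> \<tau> x lam k"
    define m where "m = lambar A b \<beta> \<gamma> \<tau> x lam k"
    define z0 where "z0 = xbar \<tau> x k"
    define z1 where "z1 = xbar \<tau> x (k + 1)"
    define B where "B = \<beta> / t\<^sup>2"
    have t: "0 < t" "t \<le> 1" using tau_pos[OF k] tau_le_1[OF k] by (auto simp: t_def)
    have B: "beta_seq \<beta> \<tau> k = B" by (simp add: beta_seq_def B_def t_def)
    have x1: "x (k + 1) = (1 - t) *\<^sub>R x k + t *\<^sub>R z1"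
      using t unfolding z1_def xbar_def by (simp add: t_def[symmetric] scaleR_diff_right)
    \<comment> \<open>The extrapolation factor makes \<open>xh\<close> the same combination of
      \<open>x k\<close> and \<open>z0\<close> as the new iterate is of \<open>x k\<close> and
      \<open>z1\<close>.\<close>
    have xh: "xh = (1 - t) *\<^sub>R x k + t *\<^sub>R z0"
    proof -
      have "z0 = x k + ((1 - \<tau> (k - 1)) / \<tau> (k - 1)) *\<^sub>R (x k - x (k - 1))"
      proof -
        have "(1 / \<tau> (k - 1)) *\<^sub>R x k = x k + ((1 - \<tau> (k - 1)) / \<tau> (k - 1)) *\<^sub>R x k"
          using tau_pos'[of "k - 1"] k by (simp add: diff_divide_distrib scaleR_diff_left)
        then show ?thesis unfolding z0_def xbar_def by (simp add: algebra_simps)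
      qed
      moreover have "xh = x k + (t * ((1 - \<tau> (k - 1)) / \<tau> (k - 1))) *\<^sub>R (x k - x (k - 1))"
        by (simp add: xh_def xhat_def t_def)
      ultimately show ?thesis
        by (simp only: scaleR_add_right scaleR_scaleR[symmetric]) (simp add: scaleR_diff_left)
    qed
    \<comment> \<open>Both multipliers correct \<open>lam k\<close> by the same residual, because
      \<open>xbreve x (k - 1)\<close> is \<open>x k\<close>.\<close>
    have lh: "lh = m + (\<gamma> * (1 - t) * B) *\<^sub>R (A *v x k - b) - ((1 - t) * B) *\<^sub>R (A *v x k - b)"
      unfolding lh_def m_def lamhat_def lambar_def xbreve_def B t_def by simp
    have m1: "lambar A b \<beta> \<gamma> \<tau> x lam (k + 1) = m - (\<gamma> * t * B) *\<^sub>R (A *v z1 - b)"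
      using lam_step[OF k] unfolding m_def z1_def B t_def .
    define g where "g = transpose A *v (B *\<^sub>R (A *v xh - b) - lh)"
    define c where "c = \<sigma> * (1 - t) / t"
    define h where "h y = y \<bullet> g + B / 2 * sqnorm_mat D (y - xh) + c / 2 * (norm (y - x k))\<^sup>2" for y
    have "is_arg_min (\<lambda>y. f y + h y) (\<lambda>y. True) (x (k + 1))"
      using x_step[OF k] unfolding xh_def[symmetric] lh_def[symmetric] B gradient_phi g_def[symmetric]
        h_def c_def t_def by (simp add: add.assoc mult.commute)
    moreover have "GDERIV h (x (k + 1)) :>
        g + B *\<^sub>R (D *v (x (k + 1) - xh)) + c *\<^sub>R (x (k + 1) - x k)"
    proof -
      have "(h has_derivative (\<lambda>v. v \<bullet> g + B / 2 * (v \<bullet> (2 *\<^sub>R (D *v (x (k + 1) - xh))))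
          + c / 2 * (v \<bullet> (2 *\<^sub>R (x (k + 1) - x k))))) (at (x (k + 1)))"
        unfolding h_def[abs_def]
        by (intro has_derivative_add has_derivative_mult_right has_derivative_inner_left has_derivative_ident
            GDERIV_sqnorm_mat[OF D_sym, unfolded gderiv_def] GDERIV_norm_diff_square[unfolded gderiv_def])
      then show ?thesis unfolding gderiv_def by (simp add: inner_add_right)
    qed
    ultimately have sub: "- (g + B *\<^sub>R (D *v (x (k + 1) - xh)) + c *\<^sub>R (x (k + 1) - x k))
        \<in> subdifferential f (x (k + 1))"
      using f_strongly_convex unfolding strongly_convex_def
      by (blast intro: neg_gradient_in_subdifferential_at_arg_min)
    \<comment> \<open>Turns the previous weight into the factor that the old iterate has in
      \<open>one_step\<close>; \<open>pen\<close> does so for the weight nested in the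
      penalty.\<close>
    have rec: "1 / (\<tau> (k - 1))\<^sup>2 = (1 - t) / t\<^sup>2" using tau_rec[OF k] by (simp add: t_def)
    have pen: "a / (2 * (\<tau> (k - 1))\<^sup>2) = a / 2 * ((1 - t) / t\<^sup>2)" for a
      unfolding rec[symmetric] by simp
    have V: "V x' l j = \<beta> * (1 / (\<tau> j)\<^sup>2) * sqnorm_mat E (xbar \<tau> x j - x')
        + (norm (lambar A b \<beta> \<gamma> \<tau> x lam j - l))\<^sup>2 / (\<gamma> * \<beta>)" for j
      unfolding V_def v_seq_def sqnorm_H0 E_def by simp
    have Ax': "A *v x' = b" using x' by (simp add: feasible_def)
    have "1 / t\<^sup>2 * (f x' - f (x (k + 1)) + l \<bullet> (A *v x (k + 1) - b)
          - (2 - \<gamma>) * \<beta> / (2 * t\<^sup>2) * (norm (A *v x (k + 1) - b))\<^sup>2)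
      - ((1 - t) / t\<^sup>2) * (f x' - f (x k) + l \<bullet> (A *v x k - b)
          - (2 - \<gamma>) * \<beta> / 2 * ((1 - t) / t\<^sup>2) * (norm (A *v x k - b))\<^sup>2)
    \<ge> 1 / 2 * (\<beta> * (1 / (\<tau> (k + 1))\<^sup>2) * sqnorm_mat E (z1 - x')
        + (norm (lambar A b \<beta> \<gamma> \<tau> x lam (k + 1) - l))\<^sup>2 / (\<gamma> * \<beta>)
        - (\<beta> / t\<^sup>2 * sqnorm_mat E (z0 - x') + (norm (m - l))\<^sup>2 / (\<gamma> * \<beta>))
        + \<sigma> * ((1 - t) / t ^ 3) * (norm (x (k + 1) - x k))\<^sup>2)"
      using one_step[OF f_strongly_convex t gamma(1) beta, of D A, folded E_def,
          OF E_sym E_psd slack[OF k, of "z1 - x'", folded t_def] x1 xh Ax'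
            lh[unfolded B_def] m1[unfolded B_def] sub[unfolded g_def B_def c_def]] .
    then show ?thesis
      unfolding G_def V z0_def[symmetric] z1_def[symmetric] m_def[symmetric] S_seq_def xbreve_def
        rec pen
      by (simp add: t_def)
  qed
  \<comment> \<open>The potential is half of \<open>V\<close> minus \<open>G\<close> at the saddle
    point: the descent inequality says that it decreases by the weighted squared step.\<close>
  have rate: "(\<lambda>k::nat. MIN i\<in>{0..int k}. (norm (xbreve x i - xbreve x (i - 1)))\<^sup>2)
            \<in> O(\<lambda>k. 1 / real k ^ 4)" if saddle: "saddle_point f A b xs lams" for xs lams
  proof (rule Min_bigo_of_weighted_decrease)
    have feas: "xs \<in> feasible A b" using saddle_point_feasible[OF saddle] by (simp add: feasible_def)
    \<comment> \<open>1/16 is the factor 1/2 of the inequality times the cube of the growth rate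
      1/2.\<close>
    show "1 / 16 * \<sigma> > 0" using sigma by simp
    show "(norm (xbreve x k - xbreve x (k - 1)))\<^sup>2 \<ge> 0" for k by simp
    show "1 / 2 * V xs lams k - G xs lams k \<ge> 0" if k: "k \<ge> 0" for k
    proof -
      \<comment> \<open>Minimality in the primal variable gives \<open>S_seq\<close> \<le> 0, as
        feasibility of \<open>xs\<close> removes its multiplier term.\<close>
      have "lagrangian f A b xs lams \<le> lagrangian f A b (x k) lams"
        using saddle unfolding saddle_point_def by blast
      then have "S_seq f A b x xs lams k \<le> 0"
        using saddle_point_feasible[OF saddle] by (simp add: S_seq_def xbreve_def lagrangian_def)
      moreover have "(2 - \<gamma>) * \<beta> / (2 * (\<tau> (k - 1))\<^sup>2) * (norm (A *v xbreve x (k - 1) - b))\<^sup>2 \<ge> 0"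
        using gamma beta by simp
      ultimately have "G xs lams k \<le> 0" unfolding G_def by (intro mult_nonneg_nonpos) auto
      moreover have "V xs lams k \<ge> 0"
        unfolding V_def v_seq_def sqnorm_H0 using E_psd beta gamma unfolding E_def by simp
      ultimately show ?thesis by simp
    qed
    show "1 / 2 * V xs lams (k + 1) - G xs lams (k + 1)
        + \<sigma> / 2 * ((1 - \<tau> k) / (\<tau> k) ^ 3) * (norm (xbreve x k - xbreve x (k - 1)))\<^sup>2
        \<le> 1 / 2 * V xs lams k - G xs lams k" if "k \<ge> 0" for k
    proof -
      define q where "q = (1 - \<tau> k) / (\<tau> k) ^ 3"
      show ?thesis
        using main[OF feas that, of lams] unfolding q_def[symmetric] by (simp add: algebra_simps)
    qed
    show "1 / 16 * \<sigma> * real (Suc n) ^ 3 \<le> \<sigma> / 2 * ((1 - \<tau> (int n)) / (\<tau> (int n)) ^ 3)" for n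
    proof -
      define a where "a = 1 / \<tau> (int n)"
      define a' where "a' = 1 / \<tau> (int n - 1)"
      note growth = inverse_tau_growth[OF tau_init tau_pos tau_rec]
      \<comment> \<open>The growth lemma gives (n + 3)/2 and (n + 2)/2; the weaker common bound
        yields the cube of \<open>Suc n\<close>.\<close>
      have "a \<ge> (real n + 1) / 2" "a' \<ge> (real n + 1) / 2"
        using growth[of "Suc n"] growth[of n] by (auto simp: a_def a'_def)
      then have "((real n + 1) / 2) * ((real n + 1) / 2)\<^sup>2 \<le> a * a'\<^sup>2"
        by (intro mult_mono power_mono) auto
      also have "a * a'\<^sup>2 = 1 / \<tau> (int n) * (1 / (\<tau> (int n - 1))\<^sup>2)"
        by (simp add: a_def a'_def power_divide)
      also have "\<dots> = (1 - \<tau> (int n)) / (\<tau> (int n)) ^ 3"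
        by (subst tau_rec) (auto simp: power2_eq_square power3_eq_cube)
      finally have "(real n + 1) ^ 3 / 8 \<le> (1 - \<tau> (int n)) / (\<tau> (int n)) ^ 3"
        by (simp add: power2_eq_square power3_eq_cube)
      then have "\<sigma> / 2 * ((real n + 1) ^ 3 / 8) \<le> \<sigma> / 2 * ((1 - \<tau> (int n)) / (\<tau> (int n)) ^ 3)"
        using sigma by (intro mult_left_mono) auto
      then show ?thesis by (simp add: add.commute)
    qed
  qed
  show ?thesis
  proof (intro conjI ballI allI impI)
    fix x' l and k :: int
    assume "x' \<in> feasible A b" "k \<ge> 0"
    from main[OF this, of l] show "1 / (\<tau> k)\<^sup>2 *
          (S_seq f A b x x' l (k + 1)
            - (2 - \<gamma>) * \<beta> / (2 * (\<tau> k)\<^sup>2) * (norm (A *v xbreve x k - b))\<^sup>2)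
        - 1 / (\<tau> (k - 1))\<^sup>2 *
          (S_seq f A b x x' l k
            - (2 - \<gamma>) * \<beta> / (2 * (\<tau> (k - 1))\<^sup>2) * (norm (A *v xbreve x (k - 1) - b))\<^sup>2)
        \<ge> 1 / 2 *
          (sqnorm_mat (H0 A D \<beta> \<gamma> \<tau> (k + 1)) (v_seq A b \<beta> \<gamma> \<tau> x lam (k + 1) - stack x' l)
            - sqnorm_mat (H0 A D \<beta> \<gamma> \<tau> k) (v_seq A b \<beta> \<gamma> \<tau> x lam k - stack x' l)
            + \<sigma> * ((1 - \<tau> k) / (\<tau> k) ^ 3) * (norm (xbreve x k - xbreve x (k - 1)))\<^sup>2)"
      unfolding G_def V_def by simp
  qed (rule rate)
qed

end
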